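(* Let $\Gamma=\{(x,y)\in\mathbb{R}^2:|x|+|y|=1\}$ and $\Gamma^*=\Gamma\setminus\{(x,x+1):x\in[-1,0]\}$. Let $f:[-1,1]\to\mathbb{R}$ be a continuous function that satisfies $$f(x+y)=f(x)+f(y),\qquad (x,y)\in\Gamma^* .$$ Then $f(z)=\lambda z$ for all $z\in[-1,1]$, with a constant $\lambda$. *)

theory Defs
  imports Complex_Main
begin

definition Gamma :: "(real \<times> real) set" where
  "Gamma = {(x, y). \<bar>x\<bar> + \<bar>y\<bar> = 1}"

text \<open>The removed side is closed: both of its endpoints \<open>(-1, 0)\<close> and \<open>(0, 1)\<close> are
  removed as well.\<close>

definition Gamma_star :: "(real \<times> real) set" where
  "Gamma_star = Gamma - {(x, x + 1) | x. x \<in> {-1..0}}"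

end

theory Submission
  imports Defs
begin

text \<open>Combining the equations of the three sides gives \<open>f (2 * t) = f t - f (- t)\<close> and
  \<open>f (- 2 * t) = f (- t) - f t\<close> for \<open>0 \<le> t \<le> 1 / 2\<close>. Hence \<open>f\<close> is odd and \<open>f (2 * t) = 2 * f t\<close>
  on that interval. The deviation of \<open>f\<close> from a linear function on \<open>[0, 1]\<close> is doubled by
  \<open>t \<mapsto> 2 * t\<close> and changes sign under \<open>t \<mapsto> 1 - t\<close>, so that its maximal modulus is zero.\<close>

lemma doubling_antisymmetric_eq_0:
  fixes k :: "real \<Rightarrow> real"
  assumes cont: "continuous_on {0..1} k"
    and double: "\<And>t. 0 \<le> t \<Longrightarrow> t \<le> 1/2 \<Longrightarrow> k (2 * t) = 2 * k t"
    and antisym: "\<And>t. 0 \<le> t \<Longrightarrow> t \<le> 1 \<Longrightarrow> k (1 - t) = - k t"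
    and z: "z \<in> {0..1}"
  shows "k z = 0"
proof -
  obtain p where p: "p \<in> {0..1}" and max: "\<And>t. t \<in> {0..1} \<Longrightarrow> \<bar>k t\<bar> \<le> \<bar>k p\<bar>"
    using continuous_attains_sup[of "{0..1::real}" "\<lambda>t. \<bar>k t\<bar>"]
      continuous_on_rabs[OF cont] by auto
  \<comment> \<open>Reflection keeps the modulus and moves the maximum point into the half where
    doubling applies.\<close>
  define q where "q = min p (1 - p)"
  have q: "0 \<le> q" "q \<le> 1/2" "\<bar>k q\<bar> = \<bar>k p\<bar>"
    using p antisym[of p] by (auto simp: q_def min_def)
  have "2 * \<bar>k p\<bar> = \<bar>k (2 * q)\<bar>"
    using double[of q] q by (simp add: abs_mult)
  also have "\<dots> \<le> \<bar>k p\<bar>"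
    using max[of "2 * q"] q by simp
  finally show ?thesis
    using max[OF z] by simp
qed

theorem theorem3p1p1:
  fixes f :: "real \<Rightarrow> real"
  assumes "continuous_on {-1..1} f"
    and "\<And>x y. (x, y) \<in> Gamma_star \<Longrightarrow> f (x + y) = f x + f y"
  shows "\<exists>c. \<forall>z\<in>{-1..1}. f z = c * z"
proof -
  have add: "f (x + y) = f x + f y" if "\<bar>x\<bar> + \<bar>y\<bar> = 1" "y \<noteq> x + 1" for x y
    using assms(2)[of x y] that by (auto simp: Gamma_star_def Gamma_def)
  have f0: "f 0 = 0"
    using add[of 1 0] by simp
  \<comment> \<open>At \<open>t = 0\<close> the point is the removed vertex (0, 1), so
    \<open>f0\<close> replaces \<open>add\<close>; likewise below for (-1, 0).\<close>
  have pos: "f t + f (1 - t) = f 1" if "0 \<le> t" "t \<le> 1" for t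
    using add[of t "1 - t"] that f0 by (cases "t = 0") auto
  have neg: "f (- t) + f (t - 1) = f (- 1)" if "0 \<le> t" "t \<le> 1" for t
    using add[of "- t" "t - 1"] that f0 by (cases "t = 1") auto
  have mixed: "f (2 * t - 1) = f t + f (t - 1)" if "0 \<le> t" "t \<le> 1" for t
    using add[of t "t - 1"] that by auto
  \<comment> \<open>\<open>neg\<close> rewrites both \<open>f (t - 1)\<close> and
    \<open>f (2 * t - 1)\<close> in \<open>mixed\<close>; the constant \<open>f (- 1)\<close>
    cancels.\<close>
  have dneg: "f (- (2 * t)) = f (- t) - f t" if "0 \<le> t" "t \<le> 1/2" for t
    using mixed[of t] neg[of t] neg[of "2 * t"] that by simp
  have dpos: "f (2 * t) = f t - f (- t)" if "0 \<le> t" "t \<le> 1/2" for t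
    using mixed[of "1 - t"] pos[of t] pos[of "2 * t"] that by simp
  have odd: "f (- t) = - f t" if "0 \<le> t" "t \<le> 1" for t
    using dneg[of "t / 2"] dpos[of "t / 2"] that by simp
  \<comment> \<open>Doubling would survive any slope; the slope \<open>f 1\<close> is what cancels
    the constant in \<open>pos\<close> and makes \<open>k\<close> antisymmetric about 1/2.\<close>
  define k where "k t = f t - f 1 * t" for t
  have linear: "f z = f 1 * z" if "z \<in> {0..1}" for z
  proof -
    have "k z = 0"
    proof (rule doubling_antisymmetric_eq_0[OF _ _ _ that])
      show "continuous_on {0..1} k"
        unfolding k_def by (intro continuous_intros continuous_on_subset[OF assms(1)]) auto
      show "k (2 * t) = 2 * k t" if "0 \<le> t" "t \<le> 1/2" for t
        using dpos[OF that] odd[of t] that by (simp add: k_def)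
      show "k (1 - t) = - k t" if "0 \<le> t" "t \<le> 1" for t
        using pos[OF that] by (simp add: k_def algebra_simps)
    qed
    then show ?thesis by (simp add: k_def)
  qed
  have "f z = f 1 * z" if "z \<in> {-1..1}" for z
    using linear[of z] linear[of "- z"] odd[of "- z"] that by (cases "0 \<le> z") auto
  then show ?thesis by blast
qed

end
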